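(* Let $c_1,c_2,c_3\in\mathbb{H}$ be three arbitrary quaternionic numbers. Then there exists a non-constant slice regular function $f:\mathbb{H}\to\mathbb{H}$, $f(q)=\sum_{k=0}^\infty q^k a_k$, such that $f(\mathbb{H})\subset\mathbb{H}\setminus\{c_1,c_2,c_3\}$.
   Context: $\mathbb{H}$ denotes the skew field of quaternions. A slice regular function $f:\mathbb{H}\to\mathbb{H}$ (entire slice regular function) is a function given by a globally convergent power series $f(q)=\sum_{k=0}^{\infty}q^k a_k$ with coefficients $a_k\in\mathbb{H}$ (on the right). *)

theory Defs
  imports "HOL-Analysis.Analysis"
begin

text \<open>
  The quaternions: \<open>Quat a b c d\<close> stands for \<open>a + b i + c j + d k\<close>, with Hamilton's
  multiplication \<open>i\<^sup>2 = j\<^sup>2 = k\<^sup>2 = i j k = -1\<close> and the Euclidean norm of \<open>\<real>\<^sup>4\<close>.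
\<close>

datatype quat = Quat (qRe: real) (qI: real) (qJ: real) (qK: real)

lemma quat_eq_iff:
  "x = y \<longleftrightarrow> qRe x = qRe y \<and> qI x = qI y \<and> qJ x = qJ y \<and> qK x = qK y"
  by (auto intro: quat.expand)

instantiation quat :: ab_group_add
begin

definition zero_quat :: quat where
  "zero_quat = Quat 0 0 0 0"

definition plus_quat :: "quat \<Rightarrow> quat \<Rightarrow> quat" where
  "x + y = Quat (qRe x + qRe y) (qI x + qI y) (qJ x + qJ y) (qK x + qK y)"

definition uminus_quat :: "quat \<Rightarrow> quat" where
  "- x = Quat (- qRe x) (- qI x) (- qJ x) (- qK x)"

definition minus_quat :: "quat \<Rightarrow> quat \<Rightarrow> quat" where
  "x - y = Quat (qRe x - qRe y) (qI x - qI y) (qJ x - qJ y) (qK x - qK y)"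

instance
  by standard
    (simp_all add: quat_eq_iff zero_quat_def plus_quat_def uminus_quat_def minus_quat_def)

end

lemma quat_sel_add_group [simp]:
  "qRe 0 = 0" "qI 0 = 0" "qJ 0 = 0" "qK 0 = 0"
  "qRe (x + y) = qRe x + qRe y" "qI (x + y) = qI x + qI y"
  "qJ (x + y) = qJ x + qJ y" "qK (x + y) = qK x + qK y"
  "qRe (- x) = - qRe x" "qI (- x) = - qI x" "qJ (- x) = - qJ x" "qK (- x) = - qK x"
  "qRe (x - y) = qRe x - qRe y" "qI (x - y) = qI x - qI y"
  "qJ (x - y) = qJ x - qJ y" "qK (x - y) = qK x - qK y"
  by (simp_all add: zero_quat_def plus_quat_def uminus_quat_def minus_quat_def)

instantiation quat :: real_vector
begin

definition scaleR_quat :: "real \<Rightarrow> quat \<Rightarrow> quat" where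
  "scaleR r x = Quat (r * qRe x) (r * qI x) (r * qJ x) (r * qK x)"

instance
  by standard (simp_all add: quat_eq_iff scaleR_quat_def algebra_simps)

end

lemma quat_sel_scaleR [simp]:
  "qRe (r *\<^sub>R x) = r * qRe x" "qI (r *\<^sub>R x) = r * qI x"
  "qJ (r *\<^sub>R x) = r * qJ x" "qK (r *\<^sub>R x) = r * qK x"
  by (simp_all add: scaleR_quat_def)

instantiation quat :: real_algebra_1
begin

definition one_quat :: quat where
  "one_quat = Quat 1 0 0 0"

definition times_quat :: "quat \<Rightarrow> quat \<Rightarrow> quat" where
  "x * y = Quat
     (qRe x * qRe y - qI x * qI y - qJ x * qJ y - qK x * qK y)
     (qRe x * qI y + qI x * qRe y + qJ x * qK y - qK x * qJ y)
     (qRe x * qJ y - qI x * qK y + qJ x * qRe y + qK x * qI y)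
     (qRe x * qK y + qI x * qJ y - qJ x * qI y + qK x * qRe y)"

instance
  by standard (simp_all add: quat_eq_iff one_quat_def times_quat_def algebra_simps)

end

lemma quat_sel_mult [simp]:
  "qRe 1 = 1" "qI 1 = 0" "qJ 1 = 0" "qK 1 = 0"
  "qRe (x * y) = qRe x * qRe y - qI x * qI y - qJ x * qJ y - qK x * qK y"
  "qI (x * y) = qRe x * qI y + qI x * qRe y + qJ x * qK y - qK x * qJ y"
  "qJ (x * y) = qRe x * qJ y - qI x * qK y + qJ x * qRe y + qK x * qI y"
  "qK (x * y) = qRe x * qK y + qI x * qJ y - qJ x * qI y + qK x * qRe y"
  by (simp_all add: one_quat_def times_quat_def)

lemma quat_sum_squares_eq_0_iff:
  "(qRe x)\<^sup>2 + (qI x)\<^sup>2 + (qJ x)\<^sup>2 + (qK x)\<^sup>2 = 0 \<longleftrightarrow> x = 0"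
  by (simp add: quat_eq_iff add_nonneg_eq_0_iff)

instantiation quat :: real_div_algebra
begin

text \<open>The inverse is the conjugate divided by the squared norm.\<close>

definition inverse_quat :: "quat \<Rightarrow> quat" where
  "inverse x = Quat (qRe x) (- qI x) (- qJ x) (- qK x) /\<^sub>R
     ((qRe x)\<^sup>2 + (qI x)\<^sup>2 + (qJ x)\<^sup>2 + (qK x)\<^sup>2)"

definition divide_quat :: "quat \<Rightarrow> quat \<Rightarrow> quat" where
  "x div y = x * inverse (y :: quat)"

instance
proof
  fix x y :: quat
  show "x div y = x * inverse y"
    by (rule divide_quat_def)
  show "inverse (0 :: quat) = 0"
    by (simp add: quat_eq_iff inverse_quat_def)
  assume "x \<noteq> 0"
  define N where "N = (qRe x)\<^sup>2 + (qI x)\<^sup>2 + (qJ x)\<^sup>2 + (qK x)\<^sup>2"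
  have N: "N \<noteq> 0"
    using \<open>x \<noteq> 0\<close> quat_sum_squares_eq_0_iff[of x] by (simp add: N_def)
  have inv: "inverse x = Quat (qRe x) (- qI x) (- qJ x) (- qK x) /\<^sub>R N"
    by (simp add: inverse_quat_def N_def)
  have "inverse N * N = 1"
    using N by simp
  then have N1: "inverse N *
      (qRe x * qRe x + qI x * qI x + qJ x * qJ x + qK x * qK x) = 1"
    by (simp add: N_def power2_eq_square)
  show "inverse x * x = 1" and "x * inverse x = 1"
    using N1 by (simp_all add: quat_eq_iff inv algebra_simps)
qed

end

instantiation quat :: real_normed_div_algebra
begin

definition norm_quat :: "quat \<Rightarrow> real" where
  "norm x = sqrt ((qRe x)\<^sup>2 + (qI x)\<^sup>2 + (qJ x)\<^sup>2 + (qK x)\<^sup>2)"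

definition sgn_quat :: "quat \<Rightarrow> quat" where
  "sgn (x :: quat) = x /\<^sub>R norm x"

definition dist_quat :: "quat \<Rightarrow> quat \<Rightarrow> real" where
  "dist (x :: quat) y = norm (x - y)"

definition uniformity_quat :: "(quat \<times> quat) filter" where
  "uniformity_quat = (INF e\<in>{0<..}. principal {(x :: quat, y). dist x y < e})"

definition open_quat :: "quat set \<Rightarrow> bool" where
  "open (U :: quat set) \<longleftrightarrow> (\<forall>x\<in>U. eventually (\<lambda>(x', y). x' = x \<longrightarrow> y \<in> U) uniformity)"

instance
proof
  fix r :: real and x y :: quat and U :: "quat set"
  show "dist x y = norm (x - y)"
    by (rule dist_quat_def)
  show "sgn x = x /\<^sub>R norm x"
    by (rule sgn_quat_def)
  show "uniformity = (INF e\<in>{0<..}. principal {(x :: quat, y). dist x y < e})"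
    by (rule uniformity_quat_def)
  show "open U \<longleftrightarrow> (\<forall>x\<in>U. eventually (\<lambda>(x', y). x' = x \<longrightarrow> y \<in> U) uniformity)"
    by (rule open_quat_def)
  show "norm x = 0 \<longleftrightarrow> x = 0"
    by (simp add: norm_quat_def quat_sum_squares_eq_0_iff)
  have norm4: "norm z = norm ((qRe z, qI z), (qJ z, qK z))" for z :: quat
    by (simp add: norm_quat_def norm_prod_def add.assoc)
  show "norm (x + y) \<le> norm x + norm y"
    using norm_triangle_ineq[of "((qRe x, qI x), (qJ x, qK x))" "((qRe y, qI y), (qJ y, qK y))"]
    by (simp add: norm4)
  show "norm (r *\<^sub>R x) = \<bar>r\<bar> * norm x"
    using norm_scaleR[of r "((qRe x, qI x), (qJ x, qK x))"]
    by (simp add: norm4)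
  have "(qRe (x * y))\<^sup>2 + (qI (x * y))\<^sup>2 + (qJ (x * y))\<^sup>2 + (qK (x * y))\<^sup>2 =
      ((qRe x)\<^sup>2 + (qI x)\<^sup>2 + (qJ x)\<^sup>2 + (qK x)\<^sup>2) *
      ((qRe y)\<^sup>2 + (qI y)\<^sup>2 + (qJ y)\<^sup>2 + (qK y)\<^sup>2)"
    unfolding quat_sel_mult by algebra
  then show "norm (x * y) = norm x * norm y"
    by (simp only: norm_quat_def real_sqrt_mult)
qed

end

definition slice_regular :: "(quat \<Rightarrow> quat) \<Rightarrow> bool" where
  "slice_regular f \<longleftrightarrow> (\<exists>a :: nat \<Rightarrow> quat. \<forall>q. (\<lambda>k. q ^ k * a k) sums f q)"

end

theory Submission
  imports Defs
begin

text \<open>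
  The three points lie in an affine plane. Choose orthonormal \<open>u\<close>, \<open>v\<close> orthogonal to its
  direction and put \<open>f q = c\<^sub>1 + cos q * u + sin q * v\<close>. On the slice \<open>q = x + y I\<close> one has
  \<open>f q - c\<^sub>m = \<alpha> + I \<beta>\<close>, where \<open>\<alpha>\<close> and \<open>\<beta>\<close> are the real and imaginary parts of the stem function
  \<open>(c\<^sub>1 - c\<^sub>m) + cos z u + sin z v\<close> at \<open>z = x + i y\<close>. Since \<open>cos\<^sup>2 z + sin\<^sup>2 z = 1\<close>, orthogonality
  gives \<open>|\<alpha>|\<^sup>2 - |\<beta>|\<^sup>2 = |c\<^sub>1 - c\<^sub>m|\<^sup>2 + 1 > 0\<close>, so that \<open>\<alpha> + I \<beta>\<close> cannot vanish.
\<close>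

instantiation quat :: real_inner
begin

definition inner_quat :: "quat \<Rightarrow> quat \<Rightarrow> real" where
  "inner x y = qRe x * qRe y + qI x * qI y + qJ x * qJ y + qK x * qK y"

instance
proof
  fix x y z :: quat and r :: real
  show "inner x y = inner y x"
    by (simp add: inner_quat_def mult.commute)
  show "inner (x + y) z = inner x z + inner y z" and "inner (r *\<^sub>R x) y = r * inner x y"
    by (simp_all add: inner_quat_def algebra_simps)
  have sq: "inner x x = (qRe x)\<^sup>2 + (qI x)\<^sup>2 + (qJ x)\<^sup>2 + (qK x)\<^sup>2"
    by (simp add: inner_quat_def power2_eq_square)
  show "0 \<le> inner x x" and "norm x = sqrt (inner x x)"
    by (simp_all add: sq norm_quat_def)
  show "inner x x = 0 \<longleftrightarrow> x = 0"
    by (simp only: sq quat_sum_squares_eq_0_iff)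
qed

end

text \<open>Gives access to dimension and orthogonal complements: real dimension 4 is what leaves
  room for both \<open>u\<close> and \<open>v\<close>.\<close>

instantiation quat :: euclidean_space
begin

definition Basis_quat :: "quat set" where
  "Basis = {Quat 1 0 0 0, Quat 0 1 0 0, Quat 0 0 1 0, Quat 0 0 0 1}"

instance
proof
  fix x u v :: quat
  show "(Basis :: quat set) \<noteq> {}" and "finite (Basis :: quat set)"
    by (simp_all add: Basis_quat_def)
  show "inner u v = (if u = v then 1 else 0)" if "u \<in> Basis" "v \<in> Basis"
    using that unfolding Basis_quat_def insert_iff empty_iff
    by (elim disjE) (simp_all add: inner_quat_def)
  show "(\<forall>u\<in>Basis. inner x u = 0) \<longleftrightarrow> x = 0"
    by (simp add: Basis_quat_def inner_quat_def quat_eq_iff[of x])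
qed

end

lemma DIM_quat: "DIM(quat) = 4"
  by (simp add: Basis_quat_def)

lemma unit_vector_orthogonal_to_finite:
  fixes S :: "'a::euclidean_space set"
  assumes "finite S" "card S < DIM('a)"
  obtains u where "norm u = 1" "\<And>s. s \<in> S \<Longrightarrow> inner u s = 0"
proof -
  have "dim S < DIM('a)"
    using assms dim_le_card' by fastforce
  then obtain x where x: "x \<noteq> 0" "\<And>y. y \<in> span S \<Longrightarrow> orthogonal x y"
    using orthogonal_to_subspace_exists by blast
  show thesis
  proof (rule that[of "x /\<^sub>R norm x"])
    fix s assume "s \<in> S"
    then have "orthogonal x s"
      using x(2) span_base by blast
    then show "inner (x /\<^sub>R norm x) s = 0"
      by (simp add: orthogonal_def)
  qed (use x(1) in simp)
qed

text \<open>When \<open>I * I = -1\<close> this embeds the complex plane as the slice spanned by 1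
  and \<open>I\<close>. Allowing any \<open>I\<close> keeps linearity free of side
  conditions.\<close>

definition quat_slice :: "quat \<Rightarrow> complex \<Rightarrow> quat" where
  "quat_slice I z = of_real (Re z) + Im z *\<^sub>R I"

lemma bounded_linear_quat_slice: "bounded_linear (quat_slice I)"
  unfolding quat_slice_def of_real_def
  by (intro bounded_linear_add bounded_linear_compose[OF bounded_linear_scaleR_left]
      bounded_linear_Re bounded_linear_Im)

lemma quat_slice_of_real [simp]: "quat_slice I (of_real r) = of_real r"
  by (simp add: quat_slice_def)

lemma quat_slice_mult:
  assumes "I * I = -1"
  shows "quat_slice I (z * w) = quat_slice I z * quat_slice I w"
  using assms
  by (simp add: quat_slice_def of_real_def algebra_simps)

lemma quat_slice_power:
  assumes "I * I = -1"
  shows "quat_slice I (z ^ k) = quat_slice I z ^ k"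
  by (induction k) (simp_all add: quat_slice_mult[OF assms], simp add: quat_slice_def)

text \<open>A purely imaginary \<open>p\<close> satisfies \<open>p * p = -|p|^2\<close>, so
  normalising the imaginary part of \<open>q\<close> yields \<open>I\<close>.\<close>

lemma quat_in_slice:
  obtains I z where "I * I = -1" "q = quat_slice I z"
proof -
  define p where "p = q - of_real (qRe q)"
  have p: "q = of_real (qRe q) + p" "qRe p = 0"
    by (simp_all add: p_def of_real_def)
  show thesis
  proof (cases "p = 0")
    case True
    then show thesis
      \<comment> \<open>A real \<open>q\<close> lies in every slice, so the choice of the unit i is
        arbitrary.\<close>
      using p that[of "Quat 0 1 0 0" "of_real (qRe q)"] by (simp add: quat_eq_iff)
  next
    case False
    have "p * p = - of_real ((norm p)\<^sup>2)"
      using p(2) by (simp add: quat_eq_iff of_real_def norm_quat_def power2_eq_square)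
    then have "(p /\<^sub>R norm p) * (p /\<^sub>R norm p) = -1"
      using False by (simp add: of_real_def power2_eq_square field_simps)
    moreover have "q = quat_slice (p /\<^sub>R norm p) (Complex (qRe q) (norm p))"
      using p False by (simp add: quat_slice_def)
    ultimately show thesis by (rule that)
  qed
qed

text \<open>Real coefficients pass through the real-linear embedding, so a complex power series
  transfers termwise, with the quaternionic factor on the right.\<close>

lemma quat_slice_mult_sums:
  assumes "I * I = -1" "(\<lambda>k. c k *\<^sub>R z ^ k) sums s"
  shows "(\<lambda>k. quat_slice I z ^ k * (c k *\<^sub>R u)) sums (quat_slice I s * u)"
proof -
  have "(\<lambda>k. quat_slice I (c k *\<^sub>R z ^ k) * u) sums (quat_slice I s * u)"
    using assms(2) bounded_linear.sums[OF bounded_linear_quat_slice]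
    by (intro sums_mult2) blast
  then show ?thesis
    by (simp add: linear_cmul[OF bounded_linear.linear[OF bounded_linear_quat_slice]]
        quat_slice_power[OF assms(1)])
qed

text \<open>Cosine and sine have real Taylor coefficients, so a single sequence \<open>a\<close>,
  independent of \<open>I\<close>, serves all slices.\<close>

lemma slice_regular_trig:
  fixes c u v :: quat
  obtains f where "slice_regular f"
    "\<And>I z. I * I = -1 \<Longrightarrow>
      f (quat_slice I z) = c + quat_slice I (cos z) * u + quat_slice I (sin z) * v"
proof -
  define a where
    "a k = (if k = 0 then c else 0) + cos_coeff k *\<^sub>R u + sin_coeff k *\<^sub>R v" for k :: nat
  have sums: "(\<lambda>k. quat_slice I z ^ k * a k) sums
      (c + quat_slice I (cos z) * u + quat_slice I (sin z) * v)" if "I * I = -1" for I z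
  proof -
    have "(\<lambda>k. if k = 0 then quat_slice I z ^ k * c else 0) sums c"
      using sums_single[of 0 "\<lambda>k. quat_slice I z ^ k * c"] by simp
    then have "(\<lambda>k. quat_slice I z ^ k * (if k = 0 then c else 0)) sums c"
      by (simp add: if_distrib cong: if_cong)
    from sums_add[OF sums_add[OF this quat_slice_mult_sums[OF that cos_converges[of z], of u]]
        quat_slice_mult_sums[OF that sin_converges[of z], of v]]
    show ?thesis
      by (simp add: a_def ring_distribs)
  qed
  define f where "f q = (\<Sum>k. q ^ k * a k)" for q
  \<comment> \<open>The slices cover all quaternions, so convergence on each slice is convergence
    everywhere.\<close>
  have "(\<lambda>k. q ^ k * a k) sums f q" for q
    unfolding f_def by (metis quat_in_slice sums sums_summable summable_sums)
  moreover have "f (quat_slice I z) = c + quat_slice I (cos z) * u + quat_slice I (sin z) * v"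
    if "I * I = -1" for I z
    unfolding f_def using sums[OF that] by (simp add: sums_iff)
  ultimately show thesis
    using that unfolding slice_regular_def by blast
qed

lemma trig_stem_nonzero:
  assumes I: "I * I = -1"
    and uv: "norm u = 1" "norm v = 1" "inner u v = 0"
    and b: "inner u b = 0" "inner v b = 0"
  shows "b + quat_slice I (cos z) * u + quat_slice I (sin z) * v \<noteq> 0"
proof
  define \<alpha> where "\<alpha> = b + Re (cos z) *\<^sub>R u + Re (sin z) *\<^sub>R v"
  define \<beta> where "\<beta> = Im (cos z) *\<^sub>R u + Im (sin z) *\<^sub>R v"
  assume "b + quat_slice I (cos z) * u + quat_slice I (sin z) * v = 0"
  then have "\<alpha> = - (I * \<beta>)"
    by (simp add: \<alpha>_def \<beta>_def quat_slice_def of_real_def algebra_simps eq_neg_iff_add_eq_0)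
  moreover have "norm I = 1"
    using arg_cong[OF I, of norm] square_eq_1_iff[of "norm I"] norm_ge_zero[of I]
    by (simp add: norm_mult del: norm_ge_zero)
  ultimately have "inner \<alpha> \<alpha> = inner \<beta> \<beta>"
    by (simp add: norm_mult flip: power2_norm_eq_inner)
  moreover have "inner u u = 1" "inner v v = 1"
    using uv by (simp_all flip: power2_norm_eq_inner)
  \<comment> \<open>Orthonormality of \<open>u\<close>, \<open>v\<close> and orthogonality to
    \<open>b\<close> remove all cross terms.\<close>
  ultimately have "inner b b + (Re (cos z))\<^sup>2 + (Re (sin z))\<^sup>2 = (Im (cos z))\<^sup>2 + (Im (sin z))\<^sup>2"
    using uv b by (simp add: \<alpha>_def \<beta>_def inner_add_left inner_add_right inner_commute
        power2_eq_square)
  moreover have "(Re (cos z))\<^sup>2 - (Im (cos z))\<^sup>2 + ((Re (sin z))\<^sup>2 - (Im (sin z))\<^sup>2) = 1"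
    using arg_cong[OF sin_cos_squared_add[of z], of Re] by (simp add: power2_eq_square)
  moreover have "inner b b \<ge> 0" by simp
  ultimately show False by linarith
qed

theorem proposition6p1:
  fixes c1 c2 c3 :: quat
  shows "\<exists>f :: quat \<Rightarrow> quat. slice_regular f \<and> \<not> f constant_on UNIV \<and>
    range f \<subseteq> UNIV - {c1, c2, c3}"
proof -
  define P where "P = {c1 - c2, c1 - c3}"
  have P: "finite P" "card P \<le> 2"
    by (simp_all add: P_def card_insert_if)
  obtain u where u: "norm u = 1" "\<And>s. s \<in> P \<Longrightarrow> inner u s = 0"
    using unit_vector_orthogonal_to_finite[of P] P DIM_quat by auto
  \<comment> \<open>At most three vectors in dimension 4, so one more orthogonal direction
    remains.\<close>
  have "finite (insert u P)" "card (insert u P) < DIM(quat)"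
    using P card_insert_le_m1[of 3 P u] DIM_quat by auto
  then obtain v where v: "norm v = 1" "\<And>s. s \<in> insert u P \<Longrightarrow> inner v s = 0"
    using unit_vector_orthogonal_to_finite[of "insert u P"] by blast
  obtain f where f: "slice_regular f" "\<And>I z. I * I = -1 \<Longrightarrow>
      f (quat_slice I z) = c1 + quat_slice I (cos z) * u + quat_slice I (sin z) * v"
    using slice_regular_trig[of c1 u v] by blast
  have "f q \<noteq> c" if "c \<in> {c1, c2, c3}" for q c
  proof -
    obtain I z where q: "I * I = -1" "q = quat_slice I z"
      by (rule quat_in_slice)
    \<comment> \<open>For \<open>c = c1\<close> the difference is zero; otherwise it lies in
      \<open>P\<close>.\<close>
    have "inner u (c1 - c) = 0" "inner v (c1 - c) = 0"
      using that u(2) v(2) by (auto simp: P_def)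
    then have "(c1 - c) + quat_slice I (cos z) * u + quat_slice I (sin z) * v \<noteq> 0"
      using q u v by (intro trig_stem_nonzero) (auto simp: inner_commute)
    then show ?thesis
      using f(2)[OF q(1), of z] q(2) by (auto simp: algebra_simps)
  qed
  moreover have "\<not> f constant_on UNIV"
  proof
    assume "f constant_on UNIV"
    then have eq: "f x = f y" for x y
      unfolding constant_on_def by (metis UNIV_I)
    define I where "I = Quat 0 1 0 0"
    have I: "I * I = -1"
      by (simp add: I_def quat_eq_iff)
    have "f (quat_slice I (of_real r)) = c1 + of_real (cos r) * u + of_real (sin r) * v" for r
      using f(2)[OF I, of "of_real r"] by (simp add: cos_of_real sin_of_real)
    \<comment> \<open>Sine vanishes at 0 and \<open>pi\<close>, while cosine is 1 and -1
      there.\<close>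
    from this[of 0] this[of pi] have "u = - u"
      using eq[of "quat_slice I (of_real 0)" "quat_slice I (of_real pi)"] by simp
    then have "inner u u = - inner u u"
      by (metis inner_minus_left)
    then show False
      using u(1) by (simp flip: power2_norm_eq_inner)
  qed
  ultimately show ?thesis
    using f(1) by blast
qed

end
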